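(* Let $K\ge 1$, $\mathcal{K}=\{1,\dots,K\}$, let $B,L,N_0>0$, and for each $k\in\mathcal{K}$ let $h_k>0$, $T_k>0$ and $\beta_k=1$. For each $k\in\mathcal{K}$ let $$ \gamma_k^{\star}=\frac{\beta_kL\ln 2}{BT_k\left[1+\mathcal{W}\left(\frac{h_k^2\nu^{\star}-BT_kN_0}{BT_kN_0e}\right)\right]}, $$ where $\nu^{\star}$ is the real number determined by $\sum_{j=1}^K\gamma_j^{\star}=1$. Then for each $k\in\mathcal{K}$, $\gamma_k^{\star}$ is a non-increasing function of $T_k$ and a non-increasing function of $h_k^2$ (in each case with all other parameters $B,L,N_0$, $T_j,h_j$ fixed).
   Context: $\mathcal{W}$ denotes the principal real branch of the Lambert $W$ function, i.e. the inverse of $w\mapsto we^w$ on $[-1,\infty)$, defined on $[-1/e,\infty)$; $e$ is Euler's number. The quantity $\gamma_k^\star$ is the optimal bandwidth fraction of device $k$ in the problem of minimizing the total uploading energy $\sum_{k=1}^K\frac{\gamma_kBt_kN_0}{h_k^2}\left(2^{\frac{\beta_kL}{\gamma_kBt_k}}-1\right)$ over $\{\gamma_k,t_k\}$ subject to $\sum_k\gamma_k=1$, $0\le\gamma_k\le1$, $0\le t_k\le T_k$, with $\nu^\star$ the Lagrange multiplier of the constraint $\sum_k\gamma_k=1$. Here $T_k$ is the maximal allowed uploading time of device $k$ and $h_k$ its channel gain. *)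

theory Defs
  imports Complex_Main
begin

text \<open>Principal real branch; only meaningful for arguments \<open>\<ge> - 1 / exp 1\<close>.\<close>

definition lambert_W :: "real \<Rightarrow> real" where
  "lambert_W = the_inv_into {-1..} (\<lambda>w. w * exp w)"

text \<open>In the next two definitions, \<open>\<beta>\<close>, \<open>T\<close> and \<open>h\<close> are the values of a single device.\<close>

definition W_arg :: "real \<Rightarrow> real \<Rightarrow> real \<Rightarrow> real \<Rightarrow> real \<Rightarrow> real" where
  "W_arg B N0 T h \<nu> = (h\<^sup>2 * \<nu> - B * T * N0) / (B * T * N0 * exp 1)"

definition bandwidth :: "real \<Rightarrow> real \<Rightarrow> real \<Rightarrow> real \<Rightarrow> real \<Rightarrow> real \<Rightarrow> real \<Rightarrow> real" where
  "bandwidth B L N0 \<beta> T h \<nu> = \<beta> * L * ln 2 / (B * T * (1 + lambert_W (W_arg B N0 T h \<nu>)))"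

text \<open>
  The multiplier is the value of \<open>\<nu>\<close> for which the fractions of the devices \<open>1, \<dots>, K\<close>
  add up to \<open>1\<close>.  It ranges over those \<open>\<nu>\<close> for which every fraction is defined: the
  argument of \<open>lambert_W\<close> lies in the domain and is not the branch point \<open>- 1 / exp 1\<close>,
  where the denominator \<open>1 + lambert_W _\<close> vanishes.
\<close>

definition multiplier ::
  "nat \<Rightarrow> real \<Rightarrow> real \<Rightarrow> real \<Rightarrow> (nat \<Rightarrow> real) \<Rightarrow> (nat \<Rightarrow> real) \<Rightarrow> (nat \<Rightarrow> real) \<Rightarrow> real"
where
  "multiplier K B L N0 \<beta> T h =
    (THE \<nu>. (\<forall>j\<in>{1..K}. W_arg B N0 (T j) (h j) \<nu> > - 1 / exp 1) \<and>
            (\<Sum>j=1..K. bandwidth B L N0 (\<beta> j) (T j) (h j) \<nu>) = 1)"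

definition opt_bandwidth ::
  "nat \<Rightarrow> real \<Rightarrow> real \<Rightarrow> real \<Rightarrow> (nat \<Rightarrow> real) \<Rightarrow> (nat \<Rightarrow> real) \<Rightarrow> (nat \<Rightarrow> real) \<Rightarrow> nat \<Rightarrow> real"
where
  "opt_bandwidth K B L N0 \<beta> T h k =
    bandwidth B L N0 (\<beta> k) (T k) (h k) (multiplier K B L N0 \<beta> T h)"

end

theory Submission
  imports Defs
begin

text \<open>
  Put \<open>u = 1 + W((x - 1) / e)\<close>, where \<open>x = h\<^sup>2 \<nu> / (B T N0)\<close>.  Then \<open>u > 0\<close> is the solution of
  \<open>\<phi>(u) = 1 + (u - 1) e\<^sup>u = x\<close>, and the fraction of the device is \<open>\<beta> L ln 2 / (B T u)\<close>.  For fixed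
  \<open>\<nu>\<close> it decreases in \<open>h\<^sup>2\<close> because \<open>\<phi>\<close> increases, and it decreases in \<open>T\<close> because
  \<open>\<phi>(u) / u\<close> increases, so that \<open>T u\<close>, which is proportional to \<open>u / \<phi>(u)\<close>, increases in \<open>T\<close>.
  Now raise one parameter of device \<open>k\<close>.  If the multiplier does not fall, the fraction of \<open>k\<close>
  decreases for both reasons; if it falls, the fractions of all other devices increase, and
  that of \<open>k\<close> decreases because they add up to \<open>1\<close>.
\<close>

section \<open>The map \<open>w * exp w\<close> and its inverse on the principal branch\<close>

lemma times_exp_less:
  fixes v w :: real
  assumes "-1 \<le> v" "v < w"
  shows "v * exp v < w * exp w"
\<comment> \<open>The derivative \<open>(1 + x) * exp x\<close> vanishes at the branch point -1, so
  its positivity is required only in the open interval.\<close>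
proof (rule DERIV_pos_imp_increasing_open[OF assms(2)])
  fix x assume "v < x" "x < w"
  then have "0 < (1 + x) * exp x"
    using assms by simp
  moreover have "((\<lambda>w. w * exp w) has_real_derivative (1 + x) * exp x) (at x)"
    by (auto intro!: derivative_eq_intros simp: algebra_simps)
  ultimately show "\<exists>y. ((\<lambda>w. w * exp w) has_real_derivative y) (at x) \<and> 0 < y"
    by blast
qed (intro continuous_intros)

lemma lambert_W_times_exp:
  assumes "-1 \<le> w"
  shows "lambert_W (w * exp w) = w"
proof -
  have "inj_on (\<lambda>w::real. w * exp w) {-1..}"
    by (rule linorder_inj_onI) (use times_exp_less in fastforce)+
  then show ?thesis
    unfolding lambert_W_def using assms by (intro the_inv_into_f_eq) auto
qed

section \<open>The shifted Lambert function and its inverse\<close>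

definition lambert_shift :: "real \<Rightarrow> real" where
  "lambert_shift x = 1 + lambert_W ((x - 1) / exp 1)"

text \<open>The function \<phi> above: put \<open>w = u - 1\<close> in
  \<open>w * exp w = (x - 1) / exp 1\<close>, multiply by \<open>exp 1\<close> and solve for
  x.\<close>

definition shift_inv :: "real \<Rightarrow> real" where
  "shift_inv u = 1 + (u - 1) * exp u"

lemma lambert_shift_shift_inv:
  assumes "0 \<le> u"
  shows "lambert_shift (shift_inv u) = u"
proof -
  have "(shift_inv u - 1) / exp 1 = (u - 1) * exp (u - 1)"
    by (simp add: shift_inv_def exp_diff)
  then show ?thesis
    using lambert_W_times_exp[of "u - 1"] assms by (simp add: lambert_shift_def)
qed

text \<open>Monotonicity of \<open>w * exp w\<close> carried over by \<open>w = u - 1\<close>; the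
  condition \<open>0 \<le> u\<close> is the branch condition \<open>-1 \<le> w\<close>.\<close>

lemma shift_inv_less:
  assumes "0 \<le> u" "u < v"
  shows "shift_inv u < shift_inv v"
proof -
  have "(u - 1) * exp (u - 1) < (v - 1) * exp (v - 1)"
    using assms by (intro times_exp_less) auto
  then have "(u - 1) * exp u / exp 1 < (v - 1) * exp v / exp 1"
    by (simp add: exp_diff)
  then show ?thesis
    by (simp add: shift_inv_def divide_less_cancel)
qed

lemma shift_inv_pos: "0 < u \<Longrightarrow> 0 < shift_inv u"
  using shift_inv_less[of 0 u] by (simp add: shift_inv_def)

lemma shift_inv_surj:
  assumes "0 < x"
  obtains u where "0 < u" "shift_inv u = x"
proof -
  \<comment> \<open>The intermediate value theorem is applied on \<open>{0..1 + x}\<close>: the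
    value at 0 is 0, and at the right end it is \<open>1 + x * exp (1 + x)\<close>, which exceeds
    x.\<close>
  have "x * 1 \<le> x * exp (1 + x)"
    using assms by (intro mult_left_mono) auto
  then have "x \<le> shift_inv (1 + x)"
    by (simp add: shift_inv_def)
  moreover have "shift_inv 0 = 0"
    by (simp add: shift_inv_def)
  moreover have "continuous_on {0..1 + x} shift_inv"
    unfolding shift_inv_def by (intro continuous_intros)
  ultimately obtain u where "0 \<le> u" "shift_inv u = x"
    using IVT'[of shift_inv 0 x "1 + x"] assms by auto
  with assms \<open>shift_inv 0 = 0\<close> have "0 < u"
    by (cases "u = 0") auto
  then show thesis
    using \<open>shift_inv u = x\<close> that by blast
qed

lemma lambert_shift_pos: "0 < x \<Longrightarrow> 0 < lambert_shift x"
  by (metis lambert_shift_shift_inv less_imp_le shift_inv_surj)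

lemma shift_inv_lambert_shift: "0 < x \<Longrightarrow> shift_inv (lambert_shift x) = x"
  by (metis lambert_shift_shift_inv less_imp_le shift_inv_surj)

lemma lambert_shift_less:
  assumes "0 < x" "x < y"
  shows "lambert_shift x < lambert_shift y"
proof (rule ccontr)
  assume "\<not> ?thesis"
  then have "shift_inv (lambert_shift y) \<le> shift_inv (lambert_shift x)"
    using shift_inv_less[of "lambert_shift y" "lambert_shift x"] lambert_shift_pos[of y] assms
    by (cases "lambert_shift x = lambert_shift y") auto
  then show False
    using assms by (simp add: shift_inv_lambert_shift)
qed

lemma lambert_shift_mono:
  assumes "0 < x" "x \<le> y"
  shows "lambert_shift x \<le> lambert_shift y"
  using lambert_shift_less[of x y] assms by (cases "x = y") auto

lemma continuous_on_lambert_shift: "continuous_on {0<..} lambert_shift"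
\<comment> \<open>A monotone function with open image is continuous; here the image is the whole
  positive half-line.\<close>
proof (rule continuous_onI_mono)
  have "lambert_shift ` {0<..} = {0<..}"
  proof (intro equalityI subsetI)
    fix u :: real assume "u \<in> {0<..}"
    then show "u \<in> lambert_shift ` {0<..}"
      by (intro image_eqI[of _ _ "shift_inv u"]) (auto simp: lambert_shift_shift_inv shift_inv_pos)
  qed (auto simp: lambert_shift_pos)
  then show "open (lambert_shift ` {0<..})"
    by simp
qed (auto intro: lambert_shift_mono)

text \<open>The numerator of the derivative is \<open>(x\<^sup>2 - x + 1) * exp x - 1\<close>. Since
  \<open>exp x \<ge> 1 + x\<close>, it is at least
  \<open>(x\<^sup>2 - x + 1) * (1 + x) - 1 = x ^ 3\<close>.\<close>

lemma shift_inv_div_mono: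
  assumes "0 < u" "u \<le> v"
  shows "shift_inv u / u \<le> shift_inv v / v"
proof (rule DERIV_nonneg_imp_nondecreasing[OF assms(2)])
  fix x assume "u \<le> x" "x \<le> v"
  then have x: "0 < x"
    using assms by simp
  have "0 \<le> x\<^sup>2 - x + 1"
    using zero_le_square[of "x - 1"] x by (simp add: power2_eq_square algebra_simps)
  then have "(x\<^sup>2 - x + 1) * (1 + x) \<le> (x\<^sup>2 - x + 1) * exp x"
    by (intro mult_left_mono exp_ge_add_one_self) auto
  moreover have "(x\<^sup>2 - x + 1) * (1 + x) = x ^ 3 + 1"
    by (simp add: power2_eq_square power3_eq_cube algebra_simps)
  ultimately have "0 \<le> (x * exp x * x - shift_inv x) / (x * x)"
    using x by (intro divide_nonneg_nonneg)
      (auto simp: shift_inv_def power2_eq_square algebra_simps intro: order_trans[rotated])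
  moreover have "(shift_inv has_real_derivative x * exp x) (at x)"
    unfolding shift_inv_def by (auto intro!: derivative_eq_intros simp: algebra_simps)
  then have "((\<lambda>u. shift_inv u / u) has_real_derivative
      (x * exp x * x - shift_inv x) / (x * x)) (at x)"
    using x by (auto intro!: derivative_eq_intros)
  ultimately show "\<exists>y. ((\<lambda>u. shift_inv u / u) has_real_derivative y) (at x) \<and> 0 \<le> y"
    by blast
qed

text \<open>For \<open>u = lambert_shift (c / t)\<close> the quotient \<open>shift_inv u / u\<close>
  equals \<open>c / (t * u)\<close>. As t grows, u falls and so does this quotient, hence
  \<open>t * u\<close> grows.\<close>

lemma mult_lambert_shift_mono:
  assumes "0 < c" "0 < s" "s \<le> t"
  shows "s * lambert_shift (c / s) \<le> t * lambert_shift (c / t)"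
proof -
  let ?v = "lambert_shift (c / s)" and ?u = "lambert_shift (c / t)"
  have pos: "0 < c / t" "0 < c / s" and le: "c / t \<le> c / s"
    using assms by (auto intro: divide_left_mono)
  have u: "0 < ?u" and v: "0 < ?v" and "?u \<le> ?v"
    using lambert_shift_pos lambert_shift_mono pos le by auto
  then have "shift_inv ?u / ?u \<le> shift_inv ?v / ?v"
    by (intro shift_inv_div_mono)
  then have "c / (t * ?u) \<le> c / (s * ?v)"
    using pos by (simp add: shift_inv_lambert_shift)
  then show ?thesis
    using assms u v by (simp add: divide_le_eq le_divide_eq field_simps)
qed

section \<open>The fraction of a single device as a function of multiplier, gain and time\<close>

lemma W_arg_eq:
  assumes "0 < B" "0 < N0" "0 < T"
  shows "W_arg B N0 T h \<nu> = (h\<^sup>2 * \<nu> / (B * T * N0) - 1) / exp 1"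
  using assms by (simp add: W_arg_def field_simps)

text \<open>The branch point corresponds to x = 0, so the domain condition on the multiplier is the
  same for every device.\<close>

lemma W_arg_gt_iff:
  assumes "0 < B" "0 < N0" "0 < T" "0 < h"
  shows "- 1 / exp 1 < W_arg B N0 T h \<nu> \<longleftrightarrow> 0 < \<nu>"
proof -
  have "0 < B * T * N0"
    using assms by simp
  have "- 1 / exp 1 < W_arg B N0 T h \<nu> \<longleftrightarrow> 0 < h\<^sup>2 * \<nu> / (B * T * N0)"
    unfolding W_arg_eq[OF assms(1-3)] by (subst divide_less_cancel) auto
  also have "\<dots> \<longleftrightarrow> 0 < \<nu>"
    using \<open>0 < B * T * N0\<close> \<open>0 < h\<close> by (simp add: pos_less_divide_eq zero_less_mult_iff)
  finally show ?thesis .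
qed

lemma bandwidth_eq:
  assumes "0 < B" "0 < N0" "0 < T"
  shows "bandwidth B L N0 \<beta> T h \<nu> =
    \<beta> * L * ln 2 / (B * T * lambert_shift (h\<^sup>2 * \<nu> / (B * T * N0)))"
  by (simp add: bandwidth_def lambert_shift_def W_arg_eq[OF assms])

context
  fixes B L N0 \<beta> :: real
  assumes B: "0 < B" and L: "0 < L" and N0: "0 < N0" and \<beta>: "0 < \<beta>"
begin

lemma bandwidth_pos:
  assumes "0 < T" "0 < h" "0 < \<nu>"
  shows "0 < bandwidth B L N0 \<beta> T h \<nu>"
  using assms B L N0 \<beta> lambert_shift_pos[of "h\<^sup>2 * \<nu> / (B * T * N0)"]
  by (simp add: bandwidth_eq)

lemma bandwidth_less:
  assumes "0 < T" "0 < h" "0 < \<mu>" "\<mu> < \<nu>"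
  shows "bandwidth B L N0 \<beta> T h \<nu> < bandwidth B L N0 \<beta> T h \<mu>"
proof -
  have pos: "0 < h\<^sup>2 * \<mu> / (B * T * N0)"
    and less: "h\<^sup>2 * \<mu> / (B * T * N0) < h\<^sup>2 * \<nu> / (B * T * N0)"
    using assms B N0 by (auto intro!: divide_strict_right_mono)
  then show ?thesis
    using lambert_shift_less[OF pos less] lambert_shift_pos[OF pos] assms B L N0 \<beta>
    by (simp add: bandwidth_eq) (intro divide_strict_left_mono; simp)
qed

lemma bandwidth_antimono_multiplier:
  assumes "0 < T" "0 < h" "0 < \<mu>" "\<mu> \<le> \<nu>"
  shows "bandwidth B L N0 \<beta> T h \<nu> \<le> bandwidth B L N0 \<beta> T h \<mu>"
  using bandwidth_less[of T h \<mu> \<nu>] assms by (cases "\<mu> = \<nu>") auto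

lemma bandwidth_antimono_gain:
  assumes "0 < T" "0 < \<nu>" "0 < g" "g \<le> h"
  shows "bandwidth B L N0 \<beta> T h \<nu> \<le> bandwidth B L N0 \<beta> T g \<nu>"
proof -
  have pos: "0 < g\<^sup>2 * \<nu> / (B * T * N0)"
    and le: "g\<^sup>2 * \<nu> / (B * T * N0) \<le> h\<^sup>2 * \<nu> / (B * T * N0)"
    using assms B N0 by (auto intro!: divide_right_mono mult_right_mono power_mono)
  then show ?thesis
    using lambert_shift_mono[OF pos le] lambert_shift_pos[OF pos] assms B L N0 \<beta>
    by (simp add: bandwidth_eq) (intro divide_left_mono; simp)
qed

lemma bandwidth_antimono_time:
  assumes "0 < h" "0 < \<nu>" "0 < s" "s \<le> t"
  shows "bandwidth B L N0 \<beta> t h \<nu> \<le> bandwidth B L N0 \<beta> s h \<nu>"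
proof -
  \<comment> \<open>With c free of the time, the argument of \<open>lambert_shift\<close> is
    \<open>c / t\<close>, and the denominator of the fraction is B times the product in
    \<open>mult_lambert_shift_mono\<close>.\<close>
  define c where "c = h\<^sup>2 * \<nu> / (B * N0)"
  have c: "0 < c" "\<And>t. h\<^sup>2 * \<nu> / (B * t * N0) = c / t"
    using assms B N0 by (auto simp: c_def mult_ac)
  show ?thesis
    using mult_lambert_shift_mono[of c s t] c lambert_shift_pos[of "c / s"]
      lambert_shift_pos[of "c / t"] assms B L N0 \<beta>
    by (simp add: bandwidth_eq mult.assoc) (intro divide_left_mono; simp)
qed

lemma bandwidth_surj:
  assumes "0 < T" "0 < h" "0 < c"
  obtains \<nu> where "0 < \<nu>" "bandwidth B L N0 \<beta> T h \<nu> = c"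
proof
  \<comment> \<open>Solve backwards: u is the value of \<open>lambert_shift\<close> that makes the
    fraction equal to c, and \<nu> is the multiplier for which \<open>lambert_shift\<close> takes
    that value.\<close>
  define u where "u = \<beta> * L * ln 2 / (B * T * c)"
  define \<nu> where "\<nu> = shift_inv u * (B * T * N0) / h\<^sup>2"
  have u: "0 < u"
    using assms B L \<beta> by (simp add: u_def)
  then show "0 < \<nu>"
    using assms B N0 shift_inv_pos by (simp add: \<nu>_def)
  have "h\<^sup>2 * \<nu> / (B * T * N0) = shift_inv u"
    using assms B N0 by (simp add: \<nu>_def)
  then have "bandwidth B L N0 \<beta> T h \<nu> = \<beta> * L * ln 2 / (B * T * u)"
    using assms u B N0 by (simp add: bandwidth_eq lambert_shift_shift_inv)
  also have "\<dots> = c"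
    using assms B L \<beta> by (simp add: u_def)
  finally show "bandwidth B L N0 \<beta> T h \<nu> = c" .
qed

lemma continuous_on_bandwidth:
  assumes "0 < T" "0 < h"
  shows "continuous_on {0<..} (bandwidth B L N0 \<beta> T h)"
proof -
  have "continuous_on {0<..} (\<lambda>\<nu>. lambert_shift (h\<^sup>2 * \<nu> / (B * T * N0)))"
    by (rule continuous_on_compose2[OF continuous_on_lambert_shift])
      (use assms B N0 in \<open>auto intro!: continuous_intros\<close>)
  moreover have "lambert_shift (h\<^sup>2 * \<nu> / (B * T * N0)) \<noteq> 0" if "0 < \<nu>" for \<nu>
    using lambert_shift_pos[of "h\<^sup>2 * \<nu> / (B * T * N0)"] that assms B N0 by simp
  ultimately show ?thesis
    unfolding bandwidth_eq[OF B N0 assms(1), abs_def]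
    using assms B by (auto intro!: continuous_intros)
qed

end

section \<open>Existence and uniqueness of the multiplier\<close>

lemma multiplier_correct:
  fixes \<beta> T h :: "nat \<Rightarrow> real"
  assumes K: "1 \<le> K" and B: "0 < B" and L: "0 < L" and N0: "0 < N0"
    and \<beta>: "\<And>j. j \<in> {1..K} \<Longrightarrow> 0 < \<beta> j"
    and T: "\<And>j. j \<in> {1..K} \<Longrightarrow> 0 < T j"
    and h: "\<And>j. j \<in> {1..K} \<Longrightarrow> 0 < h j"
  defines "\<nu> \<equiv> multiplier K B L N0 \<beta> T h"
  shows "0 < \<nu>" and "(\<Sum>j=1..K. bandwidth B L N0 (\<beta> j) (T j) (h j) \<nu>) = 1"
proof -
  let ?b = "\<lambda>j. bandwidth B L N0 (\<beta> j) (T j) (h j)"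
  let ?S = "\<lambda>\<nu>. \<Sum>j=1..K. ?b j \<nu>"
  have 1: "1 \<in> {1..K}"
    using K by simp
  \<comment> \<open>Device 1 exists, so the quantifier is not vacuous and the domain condition
    forces positivity.\<close>
  have dom: "(\<forall>j\<in>{1..K}. - 1 / exp 1 < W_arg B N0 (T j) (h j) \<mu>) \<longleftrightarrow> 0 < \<mu>" for \<mu>
    using W_arg_gt_iff[OF B N0 T h] 1 by blast
  \<comment> \<open>At \<open>\<mu>1\<close> device 1 alone takes the whole band, so the total is at
    least 1.\<close>
  obtain \<mu>1 where \<mu>1: "0 < \<mu>1" "?b 1 \<mu>1 = 1"
    using bandwidth_surj[OF B L N0 \<beta> T h, OF 1 1 1, of 1] by auto
  have "?b 1 \<mu>1 \<le> ?S \<mu>1"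
    using 1 \<mu>1 bandwidth_pos[OF B L N0 \<beta> T h]
    by (intro member_le_sum) (auto intro: less_imp_le)
  with \<mu>1 have ge: "1 \<le> ?S \<mu>1"
    by simp
  \<comment> \<open>For a total of at most 1, take the largest of the multipliers at which the
    single devices get \<open>1 / K\<close>; there every fraction is at most
    \<open>1 / K\<close>.\<close>
  have "\<exists>\<mu>>0. ?b j \<mu> = 1 / K" if "j \<in> {1..K}" for j
    using bandwidth_surj[OF B L N0 \<beta> T h, OF that that that, of "1 / K"] K
    by (metis of_nat_0_less_iff zero_less_divide_1_iff zero_less_one less_le_trans)
  then obtain m where m: "\<And>j. j \<in> {1..K} \<Longrightarrow> 0 < m j \<and> ?b j (m j) = 1 / K"
    by metis
  define \<mu>2 where "\<mu>2 = Max (m ` {1..K})"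
  have m_le: "m j \<le> \<mu>2" if "j \<in> {1..K}" for j
    using that by (simp add: \<mu>2_def)
  have "0 < \<mu>2"
    using m[OF 1] m_le[OF 1] by simp
  have "?b j \<mu>2 \<le> 1 / K" if "j \<in> {1..K}" for j
    using bandwidth_antimono_multiplier[OF B L N0 \<beta> T h, OF that that that, of "m j" \<mu>2]
      m[OF that] m_le[OF that] by simp
  then have "?S \<mu>2 \<le> (\<Sum>j=1..K. 1 / K)"
    by (rule sum_mono)
  then have le: "?S \<mu>2 \<le> 1"
    using K by simp
  have "continuous_on {0<..} ?S"
    using continuous_on_bandwidth[OF B L N0 \<beta> T h] by (intro continuous_on_sum) auto
  \<comment> \<open>Connectedness of the image yields the value 1 without any comparison of
    \<open>\<mu>1\<close> with \<open>\<mu>2\<close>.\<close>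
  then have "connected (?S ` {0<..})"
    by (intro connected_continuous_image) auto
  then have "1 \<in> ?S ` {0<..}"
    by (rule connectedD_interval[of _ "?S \<mu>2" "?S \<mu>1"])
      (use \<open>0 < \<mu>1\<close> \<open>0 < \<mu>2\<close> le ge in auto)
  then obtain \<mu> where \<mu>: "0 < \<mu>" "?S \<mu> = 1"
    by auto
  \<comment> \<open>Strict decrease of the total gives uniqueness, so the description in
    \<open>multiplier_def\<close> denotes the solution.\<close>
  have less: "?S y < ?S x" if "0 < x" "x < y" for x y
    using that 1 bandwidth_less[OF B L N0 \<beta> T h] by (intro sum_strict_mono) auto
  have "\<exists>!\<nu>. 0 < \<nu> \<and> ?S \<nu> = 1"
  proof (rule ex1I)
    show "0 < \<mu> \<and> ?S \<mu> = 1"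
      using \<mu> by simp
    show "x = \<mu>" if "0 < x \<and> ?S x = 1" for x
      using less[of x \<mu>] less[of \<mu> x] \<mu> that by (cases x \<mu> rule: linorder_cases) auto
  qed
  from theI'[OF this] show "0 < \<nu>" "?S \<nu> = 1"
    unfolding \<nu>_def multiplier_def dom by auto
qed

section \<open>Comparison of the shares before and after a change of one device\<close>

lemma balanced_share_mono:
  fixes f g :: "'a \<Rightarrow> real \<Rightarrow> real"
  assumes "finite A" and k: "k \<in> A"
    and eq: "\<And>j. j \<in> A \<Longrightarrow> j \<noteq> k \<Longrightarrow> f j = g j"
    and anti: "\<And>j x y. j \<in> A \<Longrightarrow> 0 < x \<Longrightarrow> x \<le> y \<Longrightarrow> f j y \<le> f j x"
    and le: "\<And>x. 0 < x \<Longrightarrow> g k x \<le> f k x"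
    and pos: "0 < \<mu>" "0 < \<nu>"
    and sums: "(\<Sum>j\<in>A. f j \<mu>) = (\<Sum>j\<in>A. g j \<nu>)"
  shows "g k \<nu> \<le> f k \<mu>"
proof (cases "\<mu> \<le> \<nu>")
  case True
  then show ?thesis
    using anti[OF k \<open>0 < \<mu>\<close> True] le[OF \<open>0 < \<nu>\<close>] by simp
next
  case False
  \<comment> \<open>Away from k the families agree, so moving from \<mu> down to \<nu> raises each
    of these terms; equal totals then push the term of k down.\<close>
  then have "(\<Sum>j\<in>A - {k}. f j \<mu>) \<le> (\<Sum>j\<in>A - {k}. g j \<nu>)"
    using anti pos eq by (intro sum_mono) (metis DiffE insertCI less_imp_le not_le)
  then show ?thesis
    using sums \<open>finite A\<close> k by (simp add: sum.remove)
qed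

text \<open>Reduces both claims to a comparison at a fixed multiplier: \<open>le\<close> is all that
  is asked of the change in device k, be it in time or in gain.\<close>

lemma opt_bandwidth_mono:
  fixes \<beta> T T' h h' :: "nat \<Rightarrow> real"
  assumes k: "k \<in> {1..K}" and B: "0 < B" and L: "0 < L" and N0: "0 < N0"
    and \<beta>: "\<And>j. j \<in> {1..K} \<Longrightarrow> 0 < \<beta> j"
    and T: "\<And>j. j \<in> {1..K} \<Longrightarrow> 0 < T j" "\<And>j. j \<in> {1..K} \<Longrightarrow> 0 < T' j"
    and h: "\<And>j. j \<in> {1..K} \<Longrightarrow> 0 < h j" "\<And>j. j \<in> {1..K} \<Longrightarrow> 0 < h' j"
    and eq: "\<And>j. j \<noteq> k \<Longrightarrow> T' j = T j \<and> h' j = h j"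
    and le: "\<And>\<nu>. 0 < \<nu> \<Longrightarrow>
      bandwidth B L N0 (\<beta> k) (T' k) (h' k) \<nu> \<le> bandwidth B L N0 (\<beta> k) (T k) (h k) \<nu>"
  shows "opt_bandwidth K B L N0 \<beta> T' h' k \<le> opt_bandwidth K B L N0 \<beta> T h k"
proof -
  have K: "1 \<le> K"
    using k by simp
  show ?thesis
    unfolding opt_bandwidth_def
  proof (rule balanced_share_mono[where A = "{1..K}"
        and f = "\<lambda>j. bandwidth B L N0 (\<beta> j) (T j) (h j)"
        and g = "\<lambda>j. bandwidth B L N0 (\<beta> j) (T' j) (h' j)"])
    show "(\<Sum>j = 1..K. bandwidth B L N0 (\<beta> j) (T j) (h j) (multiplier K B L N0 \<beta> T h)) =
        (\<Sum>j = 1..K. bandwidth B L N0 (\<beta> j) (T' j) (h' j) (multiplier K B L N0 \<beta> T' h'))"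
      using multiplier_correct(2)[OF K B L N0 \<beta> T(1) h(1)]
        multiplier_correct(2)[OF K B L N0 \<beta> T(2) h(2)] by simp
  qed (use k eq le bandwidth_antimono_multiplier[OF B L N0 \<beta> T(1) h(1)]
        multiplier_correct(1)[OF K B L N0 \<beta> T(1) h(1)]
        multiplier_correct(1)[OF K B L N0 \<beta> T(2) h(2)] in auto)
qed

theorem corollary1:
  fixes K :: nat and B L N0 :: real and \<beta> T h :: "nat \<Rightarrow> real"
  assumes "K \<ge> 1"
    and "B > 0" and "L > 0" and "N0 > 0"
    and "\<And>j. j \<in> {1..K} \<Longrightarrow> h j > 0"
    and "\<And>j. j \<in> {1..K} \<Longrightarrow> T j > 0"
    and "\<And>j. j \<in> {1..K} \<Longrightarrow> \<beta> j = 1"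
  shows "\<forall>k\<in>{1..K}.
      antimono_on {0<..} (\<lambda>t. opt_bandwidth K B L N0 \<beta> (T(k := t)) h k) \<and>
      antimono_on {0<..} (\<lambda>g. opt_bandwidth K B L N0 \<beta> T (h(k := sqrt g)) k)"
proof (intro ballI conjI monotone_onI)
  fix k and s t :: real
  assume k: "k \<in> {1..K}" and st: "s \<in> {0<..}" "t \<in> {0<..}" "s \<le> t"
  show "opt_bandwidth K B L N0 \<beta> (T(k := t)) h k \<le> opt_bandwidth K B L N0 \<beta> (T(k := s)) h k"
    by (rule opt_bandwidth_mono[OF k])
      (use assms k st in \<open>auto intro!: bandwidth_antimono_time\<close>)
  \<comment> \<open>The variable is the squared gain; \<open>sqrt\<close> is increasing, so
    monotonicity in the gain itself suffices.\<close>
  show "opt_bandwidth K B L N0 \<beta> T (h(k := sqrt t)) k \<le> opt_bandwidth K B L N0 \<beta> T (h(k := sqrt s)) k"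
    by (rule opt_bandwidth_mono[OF k])
      (use assms k st in \<open>auto intro!: bandwidth_antimono_gain\<close>)
qed

end
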